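(* Let $t$ be an $n$-ary term in the language of one binary operation which satisfies $$t(x,y,\dots,y) = x$$ when interpreted in $\mathcal{F}_{\mathcal{D}}(x,y)$. Then the identity $t(x_1,\dots,x_n) \approx x_1$ follows from the identities $(\mathcal{D}2)$. In particular, every absorption identity which holds in $\mathcal{F}_{\mathcal{D}}(x,y)$ is a consequence of $(\mathcal{D}2)$.
   Context: Write the binary operation as juxtaposition. $(\mathcal{D}2)$ is the family of identities $$\text{for all } n \ge 0:\quad x\big((\cdots((xy_1)y_2)\cdots)y_n\big) \approx x$$ (the case $n=0$ is $xx \approx x$). $\mathcal{D}$ is the variety of idempotent groupoids satisfying $(\mathcal{D}2)$ and $x(yx) \approx (xy)x \approx (xy)y \approx (xy)(yx) \approx xy$. $\mathcal{F}_{\mathcal{D}}(x,y)$ is the free algebra in $\mathcal{D}$ on two generators $x,y$; it has exactly four elements $x,y,xy,yx$, with $x\cdot x = x\cdot (xy) = x$, $x \cdot y = x\cdot (yx) = xy$, $y \cdot y = y\cdot (yx) = y$, $y\cdot x = y \cdot (xy) = yx$, and $(xy)\cdot u = xy$, $(yx)\cdot u = yx$ for every element $u$. An absorption identity is an identity of the form $t(x_1,\dots,x_n) \approx x_i$ with $t$ a term. *)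

theory Defs
  imports Main
begin

datatype (vars: 'v) trm = Var 'v | App "'v trm" "'v trm" (infixl \<open>\<cdot>\<close> 75)

primrec eval :: "('a \<Rightarrow> 'a \<Rightarrow> 'a) \<Rightarrow> ('v \<Rightarrow> 'a) \<Rightarrow> 'v trm \<Rightarrow> 'a" where
  "eval m a (Var v) = a v"
| "eval m a (s \<cdot> t) = m (eval m a s) (eval m a t)"

text \<open>Substitution is evaluation in the term algebra.\<close>

abbreviation subst :: "('v \<Rightarrow> 'w trm) \<Rightarrow> 'v trm \<Rightarrow> 'w trm" where
  "subst \<equiv> eval App"

definition satisfies :: "('a \<Rightarrow> 'a \<Rightarrow> 'a) \<Rightarrow> 'v trm \<Rightarrow> 'v trm \<Rightarrow> bool" where
  "satisfies m s t \<longleftrightarrow> (\<forall>a. eval m a s = eval m a t)"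

text \<open>Consequence is derivability in equational logic. It is polymorphic in the variables of the
  conclusion, so that the same relation can be used for terms over a set of generators.\<close>

inductive derivable :: "(nat trm \<times> nat trm) set \<Rightarrow> 'v trm \<Rightarrow> 'v trm \<Rightarrow> bool"
  for E where
  ax: "(s, t) \<in> E \<Longrightarrow> derivable E (subst \<sigma> s) (subst \<sigma> t)"
| refl: "derivable E t t"
| sym: "derivable E s t \<Longrightarrow> derivable E t s"
| trans: "derivable E s t \<Longrightarrow> derivable E t u \<Longrightarrow> derivable E s u"
| cong: "derivable E s s' \<Longrightarrow> derivable E t t' \<Longrightarrow> derivable E (s \<cdot> t) (s' \<cdot> t')"

lemma eval_subst: "eval m a (subst \<sigma> t) = eval m (\<lambda>v. eval m a (\<sigma> v)) t"
  by (induction t) auto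

lemma derivable_sound:
  assumes "derivable E s t" and "\<And>l r. (l, r) \<in> E \<Longrightarrow> satisfies m l r"
  shows "satisfies m s t"
  using assms(1)
  by induction (use assms(2) in \<open>auto simp: satisfies_def eval_subst\<close>)

text \<open>In the following identities, \<open>Var 0\<close> is $x$. In \<open>D2_ids\<close>, \<open>Var i\<close> is $y_i$ for
  $i \ge 1$; in \<open>D_ids\<close>, \<open>Var 1\<close> is $y$ in the two-variable identities.\<close>

definition D2_ids :: "(nat trm \<times> nat trm) set" where
  "D2_ids = {(Var 0 \<cdot> foldl App (Var 0) (map Var [1..<n+1]), Var 0) | n. True}"

definition D_ids :: "(nat trm \<times> nat trm) set" where
  "D_ids = D2_ids \<union>
    (let x = Var 0; y = Var 1 in
      {(x \<cdot> x, x),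
       (x \<cdot> (y \<cdot> x), x \<cdot> y),
       ((x \<cdot> y) \<cdot> x, x \<cdot> y),
       ((x \<cdot> y) \<cdot> y, x \<cdot> y),
       ((x \<cdot> y) \<cdot> (y \<cdot> x), x \<cdot> y)})"

datatype gen = X | Y

text \<open>The free algebra on two generators in the variety axiomatized by \<open>D_ids\<close>: terms in the
  generators modulo the equational theory. Its freeness is proved in \<open>FD_free\<close>.\<close>

quotient_type FD = "gen trm" / "derivable D_ids"
  by (rule equivpI) (auto intro!: reflpI sympI transpI intro: derivable.intros)

lift_definition FD_mult :: "FD \<Rightarrow> FD \<Rightarrow> FD" is App
  by (rule derivable.cong)

lift_definition FD_x :: FD is "Var X" .
lift_definition FD_y :: FD is "Var Y" .

lemma eval_FD_mult: "eval FD_mult (\<lambda>v. abs_FD (\<sigma> v)) t = abs_FD (subst \<sigma> t)"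
  by (induction t) (auto simp: FD_mult.abs_eq)

lemma FD_in_variety:
  assumes "(l, r) \<in> D_ids"
  shows "satisfies FD_mult l r"
  unfolding satisfies_def
proof
  fix a :: "nat \<Rightarrow> FD"
  have "a = (\<lambda>v. abs_FD (rep_FD (a v)))"
    by (simp add: Quotient3_abs_rep[OF Quotient3_FD])
  then show "eval FD_mult a l = eval FD_mult a r"
    by (metis FD.abs_eq_iff derivable.ax[OF assms] eval_FD_mult)
qed

lemma FD_free:
  fixes m :: "'a \<Rightarrow> 'a \<Rightarrow> 'a"
  assumes "\<And>l r. (l, r) \<in> D_ids \<Longrightarrow> satisfies m l r"
  shows "\<exists>!h. (\<forall>u v. h (FD_mult u v) = m (h u) (h v)) \<and> h FD_x = a \<and> h FD_y = b"
proof -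
  let ?a = "case_gen a b"
  have wd: "eval m ?a s = eval m ?a t" if "derivable D_ids s t" for s t
    using derivable_sound[OF that assms] by (simp add: satisfies_def)
  define h where "h u = eval m ?a (rep_FD u)" for u
  have h_abs: "h (abs_FD t) = eval m ?a t" for t
    unfolding h_def by (rule wd) (rule Quotient3_rep_abs[OF Quotient3_FD], rule derivable.refl)
  show ?thesis
  proof (rule ex1I[of _ h], intro conjI allI)
    show "h (FD_mult u v) = m (h u) (h v)" for u v
      by (induction u, induction v) (simp add: FD_mult.abs_eq h_abs)
    show "h FD_x = a" "h FD_y = b"
      by (simp_all add: FD_x_def FD_y_def h_abs)
  next
    fix g assume g: "(\<forall>u v. g (FD_mult u v) = m (g u) (g v)) \<and> g FD_x = a \<and> g FD_y = b"
    have "g (abs_FD t) = eval m ?a t" for t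
    proof (induction t)
      case (Var v)
      then show ?case using g by (cases v) (auto simp: FD_x_def FD_y_def)
    next
      case (App s t)
      then show ?case using g by (metis FD_mult.abs_eq eval.simps(2))
    qed
    then have "g u = h u" for u
      by (induction u) (simp add: h_abs)
    then show "g = h" ..
  qed
qed

end

(* In the free algebra, t(x,y,...,y) = x forces the leftmost variable of t, and that of every
   argument along the left spine of t, to be x_1.  An argument with leftmost variable x_1 has the
   form (...(x_1 s_1)...) s_k, so it is absorbed by x_1 according to a substitution instance of
   (D2); absorbing the arguments one after another reduces t to x_1. *)

theory Submission
  imports Defs
begin

lemma eval_foldl_App: "eval m a (foldl App s ts) = foldl m (eval m a s) (map (eval m a) ts)"
  by (induction ts arbitrary: s) auto

lemma derivable_D2_absorb: "derivable D2_ids (s \<cdot> foldl App s ts) s"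
proof -
  \<comment> \<open>\<open>Var 0\<close> stands for x and the y_i start at index 1, while list
    positions start at 0; hence the shift.\<close>
  define \<sigma> where "\<sigma> i = (if i = 0 then s else ts ! (i - 1))" for i :: nat
  define n where "n = length ts"
  have "map \<sigma> [1..<n+1] = ts"
    by (rule nth_equalityI) (auto simp: \<sigma>_def n_def simp del: upt_Suc)
  then have "subst \<sigma> (Var 0 \<cdot> foldl App (Var 0) (map Var [1..<n+1])) = s \<cdot> foldl App s ts"
    by (simp add: eval_foldl_App comp_def del: upt_Suc) (simp add: \<sigma>_def)
  moreover have "subst \<sigma> (Var 0) = s"
    by (simp add: \<sigma>_def)
  moreover have "(Var 0 \<cdot> foldl App (Var 0) (map Var [1..<n+1]), Var 0) \<in> D2_ids"
    unfolding D2_ids_def by blast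
  ultimately show ?thesis
    by (metis derivable.ax)
qed

text \<open>The free algebra on two generators is coordinatized by the leftmost generator of a word
  (\<open>True\<close> for $x$) and by whether the word is a generator: $x$, $y$, $xy$, $yx$ are
  \<open>(True, True)\<close>, \<open>(False, True)\<close>, \<open>(True, False)\<close>, \<open>(False, False)\<close>.\<close>

definition pair_mult :: "bool \<times> bool \<Rightarrow> bool \<times> bool \<Rightarrow> bool \<times> bool" where
  "pair_mult u w = (fst u, snd u \<and> fst u = fst w)"

lemma pair_mult_eq_True_True_iff: "pair_mult u w = (True, True) \<longleftrightarrow> u = (True, True) \<and> fst w"
  by (cases u) (auto simp: pair_mult_def)

lemma fst_foldl_pair_mult: "fst (foldl pair_mult u ws) = fst u"
  by (induction ws arbitrary: u) (auto simp: pair_mult_def)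

lemma pair_mult_in_variety:
  assumes "(l, r) \<in> D_ids"
  shows "satisfies pair_mult l r"
  using assms unfolding D_ids_def D2_ids_def Let_def satisfies_def
  by (auto simp: eval_foldl_App fst_foldl_pair_mult pair_mult_def prod_eq_iff simp del: upt_Suc)

text \<open>Freeness supplies a homomorphism from \<open>FD\<close> to the pair model, where the
  condition can be computed.\<close>

lemma eval_pair_mult_if_eval_FD_mult:
  assumes "eval FD_mult (\<lambda>i. if i = v then FD_x else FD_y) t = FD_x"
  shows "eval pair_mult (\<lambda>i. (i = v, True)) t = (True, True)"
proof -
  obtain h where h: "\<And>u w. h (FD_mult u w) = pair_mult (h u) (h w)"
      "h FD_x = (True, True)" "h FD_y = (False, True)"
    using FD_free[OF pair_mult_in_variety] by metis
  have "h (eval FD_mult (\<lambda>i. if i = v then FD_x else FD_y) s)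
      = eval pair_mult (\<lambda>i. (i = v, True)) s" for s
    by (induction s) (auto simp: h)
  with assms h(2) show ?thesis
    by metis
qed

text \<open>A product takes its first coordinate from its left factor, so the induction descends the
  left spine only.\<close>

lemma leftmost_spine:
  assumes "fst (eval pair_mult (\<lambda>i. (i = v, c)) t)"
  obtains ts where "t = foldl App (Var v) ts"
proof -
  have "\<exists>ts. t = foldl App (Var v) ts"
    using assms
  proof (induction t)
    case (Var w)
    then show ?case by (intro exI[of _ "[]"]) simp
  next
    case (App s u)
    then obtain ts where "s = foldl App (Var v) ts"
      by (auto simp: pair_mult_def)
    then show ?case by (intro exI[of _ "ts @ [u]"]) simp
  qed
  with that show thesis by blast
qed

text \<open>A product of pairs is \<open>(True, True)\<close> only if its left factor is, so the
  induction hypothesis applies to \<open>s\<close>.\<close>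

lemma derivable_D2_if_eval_pair_mult:
  assumes "eval pair_mult (\<lambda>i. (i = v, True)) t = (True, True)"
  shows "derivable D2_ids t (Var v)"
  using assms
proof (induction t)
  case (Var w)
  then show ?case by (simp add: derivable.refl)
next
  case (App s u)
  then have s: "derivable D2_ids s (Var v)"
    by (simp add: pair_mult_eq_True_True_iff)
  have "fst (eval pair_mult (\<lambda>i. (i = v, True)) u)"
    using App.prems by (simp add: pair_mult_eq_True_True_iff)
  then obtain ts where "u = foldl App (Var v) ts"
    by (rule leftmost_spine)
  then have "derivable D2_ids (Var v \<cdot> u) (Var v)"
    by (simp add: derivable_D2_absorb)
  with s show ?case
    by (meson derivable.intros)
qed

theorem proposition33:
  fixes n :: nat and t :: "nat trm"
  assumes "n \<ge> 1" and "vars t \<subseteq> {1..n}"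
  shows "(eval FD_mult (\<lambda>i. if i = 1 then FD_x else FD_y) t = FD_x
           \<longrightarrow> derivable D2_ids t (Var 1))
       \<and> (\<forall>i\<in>{1..n}. satisfies FD_mult t (Var i) \<longrightarrow> derivable D2_ids t (Var i))"
proof -
  \<comment> \<open>An identity with right side \<open>Var v\<close> gives this premise when
    \<open>v\<close> is sent to x and all else to y.\<close>
  have *: "derivable D2_ids t (Var v)"
    if "eval FD_mult (\<lambda>i. if i = v then FD_x else FD_y) t = FD_x" for v
    using that by (intro derivable_D2_if_eval_pair_mult eval_pair_mult_if_eval_FD_mult)
  then show ?thesis
    by (simp add: satisfies_def)
qed

end
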